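(* Let $\gamma\in(0,1]$ and $p>1/\gamma$. There is a constant $C_{\gamma,p}$, depending only on $\gamma$ and $p$, such that the following holds. Let $F:[0,1]\to\mathcal{K}(\mathbb{R}^d)$ be a bounded, $\gamma$-Hölder set-valued map with nonempty compact values, and let $\xi\in F(0)$. Then there exists a map $f:[0,1]\to\mathbb{R}^d$ of finite $p$-variation such that $f(t)\in F(t)$ for all $0\le t\le 1$, $f(0)=\xi$, and $$\|f\|_{p\text{-var}}\le C_{\gamma,p}\,\|F\|_\gamma.$$
   Context: $\mathcal{K}(\mathbb{R}^d)$ is the set of nonempty compact subsets of $\mathbb{R}^d$, endowed with the Hausdorff metric; $\|F\|_\gamma$ is the $\gamma$-Hölder semi-norm of $F$ with respect to the Hausdorff metric. For a (not necessarily continuous) map $f:[0,1]\to\mathbb{R}^d$, $\|f\|_{p\text{-var}}$ is defined by $\|f\|_{p\text{-var}}^p:=\sup\sum_i|f(s_{i+1})-f(s_i)|^p$, the supremum being over finite partitions $\{s_i\}$ of $[0,1]$; $f$ has finite $p$-variation if this is finite. *)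

theory Defs
  imports "HOL-Analysis.Analysis"
begin

text \<open>
  The constant of the theorem must not depend on the dimension, so the dimension has to be
  quantified inside the formula. Hence \<open>\<real>\<^sup>d\<close> is the carrier \<open>topspace (Euclidean_space d)\<close>, i.e.
  the sequences \<open>x :: nat \<Rightarrow> real\<close> vanishing from index \<open>d\<close> on, with the following distance
  (and not the \<open>dist\<close> of the type \<open>nat \<Rightarrow> real\<close>).
\<close>

definition euclid_dist :: "nat \<Rightarrow> (nat \<Rightarrow> real) \<Rightarrow> (nat \<Rightarrow> real) \<Rightarrow> real" where
  "euclid_dist d x y = L2_set (\<lambda>i. x i - y i) {..<d}"

lemma Metric_space_euclid_dist:
  "Metric_space (topspace (Euclidean_space d)) (euclid_dist d)"
proof
  show "0 \<le> euclid_dist d x y" for x y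
    by (simp add: euclid_dist_def)
  show "euclid_dist d x y = euclid_dist d y x" for x y
    by (simp add: euclid_dist_def L2_set_def power2_commute)
  show "euclid_dist d x y = 0 \<longleftrightarrow> x = y"
    if "x \<in> topspace (Euclidean_space d)" "y \<in> topspace (Euclidean_space d)" for x y
    using that unfolding euclid_dist_def topspace_Euclidean_space
    by (auto simp: L2_set_eq_0_iff fun_eq_iff) (metis lessThan_iff not_le)
  show "euclid_dist d x z \<le> euclid_dist d x y + euclid_dist d y z" for x y z
    using L2_set_triangle_ineq [of "\<lambda>i. x i - y i" "\<lambda>i. y i - z i" "{..<d}"]
    by (simp add: euclid_dist_def)
qed

lemma mtopology_euclid_dist:
  "Metric_space.mtopology (topspace (Euclidean_space d)) (euclid_dist d) = Euclidean_space d"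
proof -
  interpret Metric_space "topspace (Euclidean_space d)" "euclid_dist d"
    by (rule Metric_space_euclid_dist)
  have coord: "continuous_map (Euclidean_space d) euclideanreal (\<lambda>x. x i)" for i
    unfolding Euclidean_space_def
    by (rule continuous_map_from_subtopology) (rule continuous_map_product_projection, simp)
  have "continuous_map (Euclidean_space d) euclideanreal (\<lambda>y. euclid_dist d x y)" for x
    unfolding euclid_dist_def L2_set_def
    by (intro continuous_intros coord) auto
  then have ball: "openin (Euclidean_space d) {y \<in> topspace (Euclidean_space d). euclid_dist d x y \<in> {..<r}}"
    for x r
    by (rule openin_continuous_map_preimage) auto
  have 1: "openin (Euclidean_space d) U" if U: "openin mtopology U" for U
  proof (subst openin_subopen, safe)
    fix x assume x: "x \<in> U"
    then obtain r where "r > 0" "mball x r \<subseteq> U" and "U \<subseteq> topspace (Euclidean_space d)"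
      using U by (auto simp: openin_mtopology)
    then show "\<exists>T. openin (Euclidean_space d) T \<and> x \<in> T \<and> T \<subseteq> U"
      using x ball [of x r]
      by (intro exI [of _ "{y \<in> topspace (Euclidean_space d). euclid_dist d x y \<in> {..<r}}"])
         (auto simp: mball_def)
  qed
  have "continuous_map mtopology euclideanreal (\<lambda>x. x i)" for i
  proof (cases "i < d")
    case True
    have lip: "\<bar>x i - y i\<bar> \<le> euclid_dist d x y" for x y
      using member_le_L2_set [of "{..<d}" i "\<lambda>i. \<bar>x i - y i\<bar>"] True
      by (simp add: euclid_dist_def L2_set_def)
    have "continuous_map mtopology Met_TC.mtopology (\<lambda>x. x i)"
      unfolding Met_TC.continuous_map_to_metric
    proof (intro ballI allI impI)
      fix x :: "nat \<Rightarrow> real" and e :: real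
      assume x: "x \<in> topspace mtopology" and e: "e > 0"
      have "\<forall>y\<in>mball x e. y i \<in> Met_TC.mball (x i) e"
        using lip by (auto simp: dist_real_def) (smt (verit))
      then show "\<exists>U. openin mtopology U \<and> x \<in> U \<and> (\<forall>y\<in>U. y i \<in> Met_TC.mball (x i) e)"
        using x e openin_mball centre_in_mball_iff topspace_mtopology by metis
    qed
    then show ?thesis by simp
  next
    case False
    have "x i = 0" if "x \<in> topspace mtopology" for x
      using that False by (subst (asm) topspace_mtopology) (simp add: topspace_Euclidean_space)
    moreover have "continuous_map mtopology euclideanreal (\<lambda>x. 0)" by simp
    ultimately show ?thesis
      by (metis (no_types, lifting) continuous_map_eq)
  qed
  then have "continuous_map mtopology (powertop_real UNIV) (\<lambda>x. x)"
    by (simp add: continuous_map_componentwise_UNIV)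
  moreover have "(\<lambda>x. x) \<in> topspace mtopology \<rightarrow> {x. \<forall>i\<ge>d. x i = 0}"
    by (subst topspace_mtopology) (auto simp: topspace_Euclidean_space)
  ultimately have "continuous_map mtopology (subtopology (powertop_real UNIV) {x. \<forall>i\<ge>d. x i = 0}) (\<lambda>x. x)"
    by (simp only: continuous_map_in_subtopology simp_thms)
  then have id: "continuous_map mtopology (Euclidean_space d) (\<lambda>x. x)"
    by (simp only: Euclidean_space_def [symmetric])
  have 2: "openin mtopology U" if U: "openin (Euclidean_space d) U" for U
  proof -
    have "{x \<in> topspace mtopology. x \<in> U} = U"
      using openin_subset [OF U] by auto
    then show ?thesis
      using openin_continuous_map_preimage [OF id U] by simp
  qed
  show ?thesis
    using 1 2 by (auto simp: topology_eq)
qed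

text \<open>
  The suprema and infima below are taken in \<open>real\<close>. They are the mathematical ones for nonempty
  compact \<open>A\<close>, \<open>B\<close> (for \<open>hausdorff_dist\<close>), and under \<open>holder\<close> resp. \<open>finite_pvar\<close> (for
  \<open>holder_seminorm\<close>, \<open>pvar_norm\<close>).
\<close>

definition hausdorff_dist :: "('a \<Rightarrow> 'a \<Rightarrow> real) \<Rightarrow> 'a set \<Rightarrow> 'a set \<Rightarrow> real" where
  "hausdorff_dist \<delta> A B = max (SUP a\<in>A. INF b\<in>B. \<delta> a b) (SUP b\<in>B. INF a\<in>A. \<delta> a b)"

definition holder_quotients :: "('b \<Rightarrow> 'b \<Rightarrow> real) \<Rightarrow> real \<Rightarrow> (real \<Rightarrow> 'b) \<Rightarrow> real set" where
  "holder_quotients \<delta> \<gamma> F =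
     {\<delta> (F s) (F t) / \<bar>s - t\<bar> powr \<gamma> | s t. s \<in> {0..1} \<and> t \<in> {0..1} \<and> s \<noteq> t}"

definition holder :: "('b \<Rightarrow> 'b \<Rightarrow> real) \<Rightarrow> real \<Rightarrow> (real \<Rightarrow> 'b) \<Rightarrow> bool" where
  "holder \<delta> \<gamma> F \<longleftrightarrow> bdd_above (holder_quotients \<delta> \<gamma> F)"

definition holder_seminorm :: "('b \<Rightarrow> 'b \<Rightarrow> real) \<Rightarrow> real \<Rightarrow> (real \<Rightarrow> 'b) \<Rightarrow> real" where
  "holder_seminorm \<delta> \<gamma> F = Sup (holder_quotients \<delta> \<gamma> F)"

definition pvar_sums :: "('b \<Rightarrow> 'b \<Rightarrow> real) \<Rightarrow> real \<Rightarrow> (real \<Rightarrow> 'b) \<Rightarrow> real set" where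
  "pvar_sums \<delta> p f =
     {\<Sum>i<n. \<delta> (f (s (Suc i))) (f (s i)) powr p | (n::nat) (s :: nat \<Rightarrow> real).
        s 0 = 0 \<and> s n = 1 \<and> (\<forall>i<n. s i < s (Suc i))}"

definition finite_pvar :: "('b \<Rightarrow> 'b \<Rightarrow> real) \<Rightarrow> real \<Rightarrow> (real \<Rightarrow> 'b) \<Rightarrow> bool" where
  "finite_pvar \<delta> p f \<longleftrightarrow> bdd_above (pvar_sums \<delta> p f)"

definition pvar_norm :: "('b \<Rightarrow> 'b \<Rightarrow> real) \<Rightarrow> real \<Rightarrow> (real \<Rightarrow> 'b) \<Rightarrow> real" where
  "pvar_norm \<delta> p f = Sup (pvar_sums \<delta> p f) powr (1 / p)"

end

theory Submission
  imports Defs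
begin

text \<open>
  Let \<open>t\<^sub>n\<close> be the largest multiple of \<open>2\<^sup>-\<^sup>n\<close> below \<open>t\<close>. Starting from \<open>\<xi>\<close>, walk along
  \<open>t\<^sub>0, t\<^sub>1, t\<^sub>2, \<dots>\<close>, each time moving to a nearest point of \<open>F t\<^sub>n\<close>; the step \<open>n\<close> has length at most
  \<open>L 2\<^sup>-\<^sup>n\<^sup>\<gamma>\<close>, so the walk stays within a multiple of \<open>L 2\<^sup>-\<^sup>n\<^sup>\<gamma>\<close> of its \<open>n\<close>-th point and, by compactness,
  has a limit \<open>f t\<close> in \<open>F t\<close>. For \<open>s < t\<close> let \<open>n\<close> be minimal such that \<open>(s, t]\<close> contains a multiple
  \<open>u\<close> of \<open>2\<^sup>-\<^sup>n\<close>. The walks of \<open>s\<close> and \<open>t\<close> agree before the step \<open>n\<close>, so \<open>|f t - f s|\<close> is at most a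
  multiple of \<open>L 2\<^sup>-\<^sup>n\<^sup>\<gamma>\<close>. Distinct intervals of a partition have distinct \<open>u\<close>, and there are at most
  \<open>2\<^sup>n\<close> of them at level \<open>n\<close>; hence the \<open>p\<close>-variation sums are dominated by the geometric series
  \<open>\<Sum>n. 2\<^sup>n 2\<^sup>-\<^sup>n\<^sup>\<gamma>\<^sup>p\<close>.
\<close>

section \<open>Dyadic floors and dyadic points that separate two times\<close>

definition dyadic_floor :: "nat \<Rightarrow> real \<Rightarrow> real" where
  "dyadic_floor n t = \<lfloor>2 ^ n * t\<rfloor> / 2 ^ n"

lemma dyadic_floor_le: "dyadic_floor n t \<le> t"
  by (simp add: dyadic_floor_def field_simps)

lemma dyadic_floor_gt: "t - dyadic_floor n t < 1 / 2 ^ n"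
proof -
  have "2 ^ n * t < \<lfloor>2 ^ n * t\<rfloor> + 1" by linarith
  then have "(t - dyadic_floor n t) * 2 ^ n < 1" by (simp add: dyadic_floor_def algebra_simps)
  then show ?thesis by (simp add: pos_less_divide_eq)
qed

lemma dyadic_floor_nonneg: "0 \<le> t \<Longrightarrow> 0 \<le> dyadic_floor n t"
  by (simp add: dyadic_floor_def)

lemma floor_double_div_2: "\<lfloor>2 * x\<rfloor> div 2 = \<lfloor>x :: real\<rfloor>"
  using floor_divide_real_eq_div [of 2 "2 * x"] by simp

text \<open>Halving the level \<open>n + 1\<close> numerator with \<open>div\<close> gives the level
  \<open>n\<close> numerator, so a finer floor determines every coarser one.\<close>

lemma dyadic_floor_Suc_eqD:
  assumes "dyadic_floor (Suc n) s = dyadic_floor (Suc n) t"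
  shows "dyadic_floor n s = dyadic_floor n t"
proof -
  have "\<lfloor>2 * (2 ^ n * s)\<rfloor> = \<lfloor>2 * (2 ^ n * t)\<rfloor>"
    using assms by (simp add: dyadic_floor_def mult.assoc)
  then show ?thesis
    by (metis dyadic_floor_def floor_double_div_2)
qed

text \<open>Refining by one level either keeps the floor or raises it by one fine mesh, as the floor
  of \<open>2 * x\<close> is twice that of \<open>x\<close>, or one more.\<close>

lemma dyadic_floor_Suc_diff: "\<bar>dyadic_floor n t - dyadic_floor (Suc n) t\<bar> \<le> 1 / 2 ^ Suc n"
proof -
  have *: "2 * \<lfloor>2 ^ n * t\<rfloor> \<le> \<lfloor>2 * (2 ^ n * t)\<rfloor>" "\<lfloor>2 * (2 ^ n * t)\<rfloor> \<le> 2 * \<lfloor>2 ^ n * t\<rfloor> + 1"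
    by linarith+
  have "\<bar>real_of_int (2 * \<lfloor>2 ^ n * t\<rfloor>) - real_of_int \<lfloor>2 * (2 ^ n * t)\<rfloor>\<bar> \<le> 1"
    using * by linarith
  then have "\<bar>real_of_int (2 * \<lfloor>2 ^ n * t\<rfloor>) - real_of_int \<lfloor>2 * (2 ^ n * t)\<rfloor>\<bar> / 2 ^ Suc n \<le> 1 / 2 ^ Suc n"
    by (intro divide_right_mono) auto
  also have "\<bar>real_of_int (2 * \<lfloor>2 ^ n * t\<rfloor>) - real_of_int \<lfloor>2 * (2 ^ n * t)\<rfloor>\<bar> / 2 ^ Suc n
      = \<bar>dyadic_floor n t - dyadic_floor (Suc n) t\<bar>"
    by (simp add: dyadic_floor_def abs_if field_simps)
  finally show ?thesis .
qed

text \<open>Take \<open>n\<close> as the least level at which the two floors differ, and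
  \<open>k\<close> as the numerator of the floor of \<open>t\<close> there. The floor of
  \<open>s\<close> has a smaller, nonnegative numerator, which gives \<open>1 \<le> k\<close> and
  the strict bound on \<open>s\<close>.\<close>

lemma dyadic_separation:
  assumes st: "s < t" and "0 \<le> s" "t \<le> 1"
  obtains n k :: nat
  where "1 \<le> k" "k \<le> 2 ^ n" "s < k / 2 ^ n" "k / 2 ^ n \<le> t"
    and "\<And>m. m < n \<Longrightarrow> dyadic_floor m s = dyadic_floor m t"
proof -
  define P where "P n \<longleftrightarrow> dyadic_floor n s \<noteq> dyadic_floor n t" for n
  have "\<exists>n. P n"
  proof -
    \<comment> \<open>Once the mesh is below \<open>t - s\<close>, the floor of \<open>t\<close>
      lies above \<open>s\<close>, hence above the floor of \<open>s\<close>.\<close>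
    obtain n where n: "(1/2) ^ n < t - s"
      using real_arch_pow_inv [of "t - s" "1/2"] st by auto
    then have "dyadic_floor n t > s"
      using dyadic_floor_gt [of t n] by (simp add: power_one_over)
    then show ?thesis
      using dyadic_floor_le [of n s] unfolding P_def by (intro exI [of _ n]) linarith
  qed
  then have P: "P (LEAST n. P n)" and less: "\<And>m. m < (LEAST n. P n) \<Longrightarrow> \<not> P m"
    by (auto intro: LeastI_ex dest: not_less_Least)
  define n where "n = (LEAST n. P n)"
  define k where "k = nat \<lfloor>2 ^ n * t\<rfloor>"
  have "\<lfloor>2 ^ n * s\<rfloor> \<le> \<lfloor>2 ^ n * t\<rfloor>" and s0: "0 \<le> \<lfloor>2 ^ n * s\<rfloor>"
    using assms by (auto intro!: floor_mono)
  moreover have "\<lfloor>2 ^ n * s\<rfloor> \<noteq> \<lfloor>2 ^ n * t\<rfloor>"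
    using P by (auto simp: P_def n_def dyadic_floor_def)
  ultimately have lt: "\<lfloor>2 ^ n * s\<rfloor> < int k" and k: "int k = \<lfloor>2 ^ n * t\<rfloor>"
    unfolding k_def by linarith+
  show thesis
  proof
    show "1 \<le> k" using lt s0 by linarith
    have "real k \<le> 2 ^ n * t" using k by linarith
    then show kt: "k / 2 ^ n \<le> t" by (simp add: field_simps)
    then have "k / 2 ^ n \<le> (1::real)" using assms by linarith
    then have "real k \<le> real (2 ^ n)" by (simp add: field_simps)
    then show "k \<le> 2 ^ n" by (simp only: of_nat_le_iff)
    have "2 ^ n * s < real k" using lt by linarith
    then show "s < k / 2 ^ n" by (simp add: field_simps)
    show "dyadic_floor m s = dyadic_floor m t" if "m < n" for m
      using less that unfolding n_def P_def by blast
  qed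
qed

section \<open>Walks along dyadic floors\<close>

text \<open>\<open>N s t x\<close> stands for the point of \<open>F t\<close> to which
  \<open>x\<close> in \<open>F s\<close> is moved. The extra move at level 0 is there for
  \<open>t = 1\<close>, the only time in the unit interval whose floor at level 0 is not 0.\<close>

primrec dyadic_walk :: "(real \<Rightarrow> real \<Rightarrow> 'a \<Rightarrow> 'a) \<Rightarrow> 'a \<Rightarrow> real \<Rightarrow> nat \<Rightarrow> 'a" where
  "dyadic_walk N \<xi> t 0 = N 0 (dyadic_floor 0 t) \<xi>"
| "dyadic_walk N \<xi> t (Suc n) =
     N (dyadic_floor n t) (dyadic_floor (Suc n) t) (dyadic_walk N \<xi> t n)"

text \<open>The first \<open>n\<close> levels of the walk see only floors up to level
  \<open>n\<close>, and these are determined by the last of them.\<close>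

lemma dyadic_walk_cong:
  "dyadic_floor n s = dyadic_floor n t \<Longrightarrow> dyadic_walk N \<xi> s n = dyadic_walk N \<xi> t n"
proof (induction n)
  case (Suc n)
  show ?case
    using Suc.IH [OF dyadic_floor_Suc_eqD [OF Suc.prems]] dyadic_floor_Suc_eqD [OF Suc.prems]
      Suc.prems
    by simp
qed simp

section \<open>Nearest points and limits of walks in compact sets\<close>

context Metric_space
begin

lemma compactin_nearest_point:
  assumes B: "compactin mtopology B" "B \<noteq> {}" and a: "a \<in> M"
  obtains b where "b \<in> B" "\<And>c. c \<in> B \<Longrightarrow> d a b \<le> d a c"
proof -
  have "continuous_map mtopology euclideanreal (\<lambda>x. d a x)"
    using a continuous_on_mdist [of a "metric (M, d)"] by simp
  then have "compactin euclideanreal ((\<lambda>x. d a x) ` B)"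
    using B image_compactin by blast
  then show ?thesis
    using compact_attains_inf [of "(\<lambda>x. d a x) ` B"] B that by auto
qed

text \<open>Compactness of \<open>B\<close> makes the infimum attained; boundedness of
  \<open>A \<union> B\<close> ensures that the supremum over \<open>A\<close> in \<open>real\<close>
  is an upper bound.\<close>

lemma hausdorff_dist_nearest_point:
  assumes A: "compactin mtopology A" and B: "compactin mtopology B" "B \<noteq> {}" and a: "a \<in> A"
  obtains b where "b \<in> B" "d a b \<le> hausdorff_dist d A B"
proof -
  have "A \<subseteq> M" "B \<subseteq> M"
    using A B compactin_subset_topspace by force+
  then have aM: "a \<in> M"
    using a by blast
  obtain b where b: "b \<in> B" and min: "\<And>c. c \<in> B \<Longrightarrow> d a b \<le> d a c"
    using compactin_nearest_point [OF B aM] by blast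
  have bdd_below: "bdd_below (d x ` B)" for x
    by (intro bdd_belowI [of _ 0]) auto
  have "mbounded (A \<union> B)"
    using A B by (simp add: compactin_imp_mbounded mbounded_Un)
  then obtain c where c: "\<And>x y. x \<in> A \<Longrightarrow> y \<in> B \<Longrightarrow> d x y \<le> c"
    unfolding mbounded_alt by blast
  have "bdd_above ((\<lambda>a. INF b\<in>B. d a b) ` A)"
    by (intro bdd_aboveI [of _ c]) (use b c bdd_below in \<open>auto intro: cINF_lower2\<close>)
  then have "(INF b\<in>B. d a b) \<le> hausdorff_dist d A B"
    unfolding hausdorff_dist_def using a cSUP_upper by fastforce
  moreover have "d a b \<le> (INF b\<in>B. d a b)"
    using B min by (intro cINF_greatest) auto
  ultimately show thesis
    using that b by force
qed

text \<open>In the constant, \<open>2 / (r * (1 - r))\<close> accounts for two geometric tails from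
  level \<open>n - 1\<close>, the last one where the walks must agree. The summand 2 pays for the
  two first moves from \<open>\<xi>\<close> when \<open>n = 0\<close>.\<close>

lemma dyadic_walk_selection:
  fixes F :: "real \<Rightarrow> 'a set"
  assumes cpt: "\<And>t. t \<in> {0..1} \<Longrightarrow> compactin mtopology (F t)"
    and near: "\<And>s t x. s \<in> {0..1} \<Longrightarrow> t \<in> {0..1} \<Longrightarrow> x \<in> F s \<Longrightarrow>
                 \<exists>y\<in>F t. d x y \<le> L * \<bar>s - t\<bar> powr \<gamma>"
    and "0 < \<gamma>" and "0 \<le> L" and \<xi>: "\<xi> \<in> F 0"
  defines "r \<equiv> 2 powr -\<gamma>"
  obtains f where "\<And>t. t \<in> {0..1} \<Longrightarrow> f t \<in> F t" "f 0 = \<xi>"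
    and "\<And>s t n. s \<in> {0..1} \<Longrightarrow> t \<in> {0..1} \<Longrightarrow>
           (\<And>m. m < n \<Longrightarrow> dyadic_floor m s = dyadic_floor m t) \<Longrightarrow>
           d (f t) (f s) \<le> (2 / (r * (1 - r)) + 2) * L * r ^ n"
proof -
  have r: "0 < r" "r < 1"
    using \<open>0 < \<gamma>\<close> by (auto simp: r_def powr_less_one)
  have dyadic_powr: "(1 / 2 ^ n) powr \<gamma> = r ^ n" for n
  proof -
    have "(1 / 2 ^ n) powr \<gamma> = (2 powr (- real n)) powr \<gamma>"
      by (simp add: powr_minus_divide powr_realpow)
    also have "\<dots> = r powr real n"
      by (simp only: r_def powr_powr) (simp add: mult.commute)
    finally show ?thesis
      using r by (simp add: powr_realpow)
  qed
  define A where "A = 1 / (1 - r)"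
  have A0: "0 \<le> A" using r by (simp add: A_def)
  have FM: "x \<in> M" if "x \<in> F t" "t \<in> {0..1}" for x t
    using that cpt compactin_subset_topspace by fastforce
  obtain N where NF: "\<And>s t x. s \<in> {0..1} \<Longrightarrow> t \<in> {0..1} \<Longrightarrow> x \<in> F s \<Longrightarrow> N s t x \<in> F t"
    and Nd: "\<And>s t x. s \<in> {0..1} \<Longrightarrow> t \<in> {0..1} \<Longrightarrow> x \<in> F s \<Longrightarrow>
               d x (N s t x) \<le> L * \<bar>s - t\<bar> powr \<gamma>"
    using near by metis
  define X where "X = dyadic_walk N \<xi>"
  have fl: "dyadic_floor n t \<in> {0..1}" if "t \<in> {0..1}" for n t
    using that dyadic_floor_le [of n t] dyadic_floor_nonneg [of t n] by auto
  have XF: "X t n \<in> F (dyadic_floor n t)" if "t \<in> {0..1}" for t n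
    by (induction n) (use that \<xi> fl NF in \<open>auto simp: X_def\<close>)
  have XM: "X t n \<in> M" if "t \<in> {0..1}" for t n
    using FM XF fl that by blast
  have X_step: "d (X t n) (X t (Suc n)) \<le> L * r ^ Suc n" if "t \<in> {0..1}" for t n
  proof -
    have "d (X t n) (X t (Suc n)) \<le> L * \<bar>dyadic_floor n t - dyadic_floor (Suc n) t\<bar> powr \<gamma>"
      using Nd [OF fl fl XF] that by (simp add: X_def)
    also have "\<dots> \<le> L * (1 / 2 ^ Suc n) powr \<gamma>"
      using dyadic_floor_Suc_diff \<open>0 < \<gamma>\<close> \<open>0 \<le> L\<close> by (intro mult_left_mono powr_mono2) auto
    finally show ?thesis by (simp only: dyadic_powr)
  qed
  have X_tail: "d (X t n) (X t m) \<le> A * L * r ^ n" if t: "t \<in> {0..1}" and "n \<le> m" for t n m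
  proof -
    \<comment> \<open>Keeping the subtracted power in the bound closes the induction, since
      \<open>A * (1 - r) = 1\<close>.\<close>
    have "d (X t n) (X t (n + k)) \<le> A * L * (r ^ n - r ^ (n + k))" for k
    proof (induction k)
      case (Suc k)
      have "d (X t n) (X t (n + Suc k)) \<le> d (X t n) (X t (n + k)) + d (X t (n + k)) (X t (Suc (n + k)))"
        using XM t triangle by simp
      also have "\<dots> \<le> A * L * (r ^ n - r ^ (n + k)) + L * r ^ Suc (n + k)"
        using Suc X_step [OF t] by (intro add_mono)
      also have "L * r ^ Suc (n + k) \<le> L * r ^ (n + k)"
        using r \<open>0 \<le> L\<close> by (intro mult_left_mono power_decreasing) auto
      also have "L * r ^ (n + k) = A * L * (r ^ (n + k) - r ^ (n + Suc k))"
        using r by (simp add: A_def field_simps)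
      finally show ?case by (simp add: algebra_simps)
    qed (use XM t in simp)
    from this [of "m - n"] have "d (X t n) (X t m) \<le> A * L * (r ^ n - r ^ m)"
      using \<open>n \<le> m\<close> by simp
    also have "\<dots> \<le> A * L * r ^ n"
      using r A0 \<open>0 \<le> L\<close> by (intro mult_left_mono) auto
    finally show ?thesis .
  qed
  have r_lim: "(\<lambda>n. r ^ n) \<longlonglongrightarrow> 0"
    using r by (intro LIMSEQ_realpow_zero) auto
  have lim: "\<exists>y\<in>F t. \<forall>n. d y (X t n) \<le> A * L * r ^ n" if t: "t \<in> {0..1}" for t
  proof -
    \<comment> \<open>The walk runs through the sets at the floors of \<open>t\<close>, not through
      \<open>F t\<close>. Its points are moved into \<open>F t\<close> so that compactness applies;
      completeness of the space is not assumed.\<close>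
    have "\<exists>y\<in>F t. d (X t n) y \<le> L * r ^ n" for n
    proof -
      obtain y where y: "y \<in> F t" "d (X t n) y \<le> L * \<bar>dyadic_floor n t - t\<bar> powr \<gamma>"
        using near [OF fl [OF t] t XF [OF t]] by blast
      have "\<bar>dyadic_floor n t - t\<bar> powr \<gamma> \<le> (1 / 2 ^ n) powr \<gamma>"
        using dyadic_floor_gt [of t n] dyadic_floor_le [of n t] \<open>0 < \<gamma>\<close>
        by (intro powr_mono2) auto
      then have "L * \<bar>dyadic_floor n t - t\<bar> powr \<gamma> \<le> L * r ^ n"
        using \<open>0 \<le> L\<close> by (simp add: dyadic_powr mult_left_mono)
      with y show ?thesis by force
    qed
    then obtain Y where YF: "\<And>n. Y n \<in> F t" and Yd: "\<And>n. d (X t n) (Y n) \<le> L * r ^ n"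
      by metis
    then obtain y \<rho> where y: "y \<in> F t" and \<rho>: "strict_mono \<rho>"
      and lim: "limitin mtopology (Y \<circ> \<rho>) y sequentially"
      using cpt [OF t] unfolding compactin_sequentially by (metis image_subsetI)
    have "d y (X t n) \<le> A * L * r ^ n" for n
    proof (rule Lim_bounded2)
      have "(\<lambda>k. d (Y (\<rho> k)) y) \<longlonglongrightarrow> 0"
        using lim by (auto simp: limit_metric_sequentially o_def limitin_metric_dist_null)
      moreover have "(\<lambda>k. r ^ \<rho> k) \<longlonglongrightarrow> 0"
        using LIMSEQ_subseq_LIMSEQ [OF r_lim \<rho>] by (simp add: o_def)
      ultimately have "(\<lambda>k. d (Y (\<rho> k)) y + L * r ^ \<rho> k + A * L * r ^ n) \<longlonglongrightarrow> 0 + L * 0 + A * L * r ^ n"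
        by (intro tendsto_intros)
      then show "(\<lambda>k. d (Y (\<rho> k)) y + L * r ^ \<rho> k + A * L * r ^ n) \<longlonglongrightarrow> A * L * r ^ n"
        by simp
      \<comment> \<open>The route from \<open>y\<close> to \<open>X t n\<close> passes through
        \<open>Y (\<rho> k)\<close> and \<open>X t (\<rho> k)\<close>; the tail bound applies
        because \<open>\<rho> k \<ge> k \<ge> n\<close>.\<close>
      show "\<forall>k\<ge>n. d y (X t n) \<le> d (Y (\<rho> k)) y + L * r ^ \<rho> k + A * L * r ^ n"
      proof (intro allI impI)
        fix k assume "n \<le> k"
        then have "n \<le> \<rho> k"
          using seq_suble [OF \<rho>, of k] by linarith
        have "d y (X t n) \<le> d y (Y (\<rho> k)) + d (Y (\<rho> k)) (X t n)"
          using FM t y YF XM by (intro triangle) auto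
        also have "d (Y (\<rho> k)) (X t n) \<le> d (Y (\<rho> k)) (X t (\<rho> k)) + d (X t (\<rho> k)) (X t n)"
          using FM t YF XM by (intro triangle) auto
        finally show "d y (X t n) \<le> d (Y (\<rho> k)) y + L * r ^ \<rho> k + A * L * r ^ n"
          using Yd [of "\<rho> k"] X_tail [OF t \<open>n \<le> \<rho> k\<close>] by (simp add: commute)
      qed
    qed
    with y show ?thesis by blast
  qed
  \<comment> \<open>All floors of 0 are 0, and a move from time 0 to itself has length at most
    \<open>L * 0 powr \<gamma> = 0\<close>.\<close>
  have X0: "X 0 n = \<xi>" for n
  proof (induction n)
    case 0
    have "d \<xi> (X 0 0) \<le> 0"
      using Nd [of 0 0 \<xi>] \<xi> by (simp add: X_def dyadic_floor_def)
    then show ?case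
      using \<xi> FM XM [of 0 0] by (metis atLeastAtMost_iff nonneg order.antisym zero zero_le_one)
  next
    case (Suc n)
    have "d (X 0 n) (X 0 (Suc n)) \<le> 0"
      using Nd [of 0 0 \<xi>] \<xi> Suc by (simp add: X_def dyadic_floor_def)
    then show ?case
      using XM [of 0] Suc by (metis atLeastAtMost_iff nonneg order.antisym zero zero_le_one)
  qed
  \<comment> \<open>At time 0 the constant walk allows \<open>\<xi>\<close> itself as the limit
    point.\<close>
  have "\<exists>y\<in>F t. (t = 0 \<longrightarrow> y = \<xi>) \<and> (\<forall>n. d y (X t n) \<le> A * L * r ^ n)" if "t \<in> {0..1}" for t
  proof (cases "t = 0")
    case True
    then show ?thesis
      using \<xi> FM [OF \<xi>] X0 A0 \<open>0 \<le> L\<close> r by (intro bexI [of _ \<xi>]) auto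
  qed (use lim that in auto)
  then obtain f where fF: "\<And>t. t \<in> {0..1} \<Longrightarrow> f t \<in> F t" and f0: "f 0 = \<xi>"
    and fd: "\<And>t n. t \<in> {0..1} \<Longrightarrow> d (f t) (X t n) \<le> A * L * r ^ n"
    by (metis atLeastAtMost_iff order_refl zero_le_one)
  have fM: "f t \<in> M" if "t \<in> {0..1}" for t
    using fF FM that by blast
  show thesis
  proof (rule that [OF fF f0])
    fix s t n assume s: "s \<in> {0..1}" and t: "t \<in> {0..1}"
      and eq: "\<And>m. m < n \<Longrightarrow> dyadic_floor m s = dyadic_floor m t"
    have chain: "d (f t) (f s) \<le> 2 * (A * L * r ^ m) + d (X t m) (X s m)" for m
    proof -
      have "d (f t) (f s) \<le> d (f t) (X t m) + d (X t m) (f s)"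
        using fM XM s t by (intro triangle)
      also have "d (X t m) (f s) \<le> d (X t m) (X s m) + d (X s m) (f s)"
        using fM XM s t by (intro triangle)
      finally show ?thesis
        using fd [OF s, of m] fd [OF t, of m] by (simp add: commute)
    qed
    show "d (f t) (f s) \<le> (2 / (r * (1 - r)) + 2) * L * r ^ n"
    proof (cases n)
      \<comment> \<open>Nothing is known to agree here, so the first points of the walks are
        compared through \<open>\<xi>\<close>.\<close>
      case 0
      have root: "d \<xi> (X u 0) \<le> L" if u: "u \<in> {0..1}" for u
      proof -
        have "d \<xi> (X u 0) \<le> L * \<bar>0 - dyadic_floor 0 u\<bar> powr \<gamma>"
          using Nd [of 0 "dyadic_floor 0 u" \<xi>] fl [OF u] \<xi> by (simp add: X_def)
        also have "\<dots> \<le> L * 1 powr \<gamma>"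
          using fl [OF u, of 0] \<open>0 < \<gamma>\<close> \<open>0 \<le> L\<close> by (intro mult_left_mono powr_mono2) auto
        finally show ?thesis by simp
      qed
      have "d (X t 0) (X s 0) \<le> d (X t 0) \<xi> + d \<xi> (X s 0)"
        using FM \<xi> XM s t by (intro triangle) auto
      then have "d (f t) (f s) \<le> 2 * (A * L) + 2 * L"
        using chain [of 0] root [OF s] root [OF t] by (simp add: commute)
      also have "2 * (A * L) \<le> 2 / (r * (1 - r)) * L"
        using r \<open>0 \<le> L\<close> by (auto simp: A_def divide_simps intro: mult_left_le)
      finally show ?thesis using 0 by (simp add: algebra_simps)
    next
      \<comment> \<open>The walks coincide at level \<open>m = n - 1\<close>; rewriting
        \<open>r ^ m\<close> as \<open>r ^ n / r\<close> produces the factor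
        \<open>1 / r\<close>.\<close>
      case (Suc m)
      then have "X t m = X s m"
        using eq [of m] dyadic_walk_cong [of m s t N \<xi>] by (simp add: X_def)
      then have "d (f t) (f s) \<le> 2 * (A * L * r ^ m)"
        using chain [of m] XM s by simp
      also have "\<dots> = 2 / (r * (1 - r)) * L * r ^ n"
        using r Suc by (simp add: A_def field_simps)
      also have "\<dots> \<le> (2 / (r * (1 - r)) + 2) * L * r ^ n"
        using r \<open>0 \<le> L\<close> by (intro mult_right_mono) auto
      finally show ?thesis .
    qed
  qed
qed

end

section \<open>Bounds on the p-variation\<close>

text \<open>Each partition interval is charged to its separating dyadic point, encoded as a pair of
  level and numerator. Level \<open>n\<close> then contributes at most
  \<open>K powr p * (2 * r powr p) ^ n\<close>.\<close>

lemma pvar_sums_le: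
  fixes \<delta> :: "'b \<Rightarrow> 'b \<Rightarrow> real"
  assumes nonneg: "\<And>x y. 0 \<le> \<delta> x y"
    and bound: "\<And>s t n. s \<in> {0..1} \<Longrightarrow> t \<in> {0..1} \<Longrightarrow>
           (\<And>m. m < n \<Longrightarrow> dyadic_floor m s = dyadic_floor m t) \<Longrightarrow> \<delta> (f t) (f s) \<le> K * r ^ n"
    and "0 \<le> K" "0 \<le> p" "0 < r" and q: "2 * r powr p < 1"
    and v: "v \<in> pvar_sums \<delta> p f"
  shows "v \<le> K powr p / (1 - 2 * r powr p)"
proof -
  define q where "q = r powr p"
  have q0: "0 < q" "2 * q < 1" using assms by (auto simp: q_def)
  obtain N :: nat and s :: "nat \<Rightarrow> real" where
    v_eq: "v = (\<Sum>i<N. \<delta> (f (s (Suc i))) (f (s i)) powr p)"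
    and s: "s 0 = 0" "s N = 1" "\<And>i. i < N \<Longrightarrow> s i < s (Suc i)"
    using v unfolding pvar_sums_def by blast
  have mono: "s i \<le> s j" if "i \<le> j" "j \<le> N" for i j
    using that
  proof (induction j rule: dec_induct)
    case (step j)
    then show ?case using s(3) [of j] by fastforce
  qed simp
  have s01: "s i \<in> {0..1}" if "i \<le> N" for i
    using mono [of 0 i] mono [of i N] that s by auto
  have "\<exists>n k. i < N \<longrightarrow> 1 \<le> k \<and> k \<le> 2 ^ n \<and> s i < real k / 2 ^ n \<and> real k / 2 ^ n \<le> s (Suc i) \<and>
      \<delta> (f (s (Suc i))) (f (s i)) \<le> K * r ^ n" for i
  proof (cases "i < N")
    case True
    then show ?thesis
      using dyadic_separation [of "s i" "s (Suc i)"] s(3) s01 [of i] s01 [of "Suc i"] bound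
      by (metis Suc_leI atLeastAtMost_iff less_imp_le)
  qed auto
  then obtain n k where k1: "\<And>i. i < N \<Longrightarrow> 1 \<le> k i" and k2: "\<And>i. i < N \<Longrightarrow> k i \<le> 2 ^ n i"
    and lo: "\<And>i. i < N \<Longrightarrow> s i < real (k i) / 2 ^ n i"
    and hi: "\<And>i. i < N \<Longrightarrow> real (k i) / 2 ^ n i \<le> s (Suc i)"
    and \<delta>: "\<And>i. i < N \<Longrightarrow> \<delta> (f (s (Suc i))) (f (s i)) \<le> K * r ^ n i"
    by metis
  define m where "m = Max (n ` {..<N})"
  have nm: "n i \<le> m" if "i < N" for i
    using that by (auto simp: m_def)
  \<comment> \<open>The separating point of interval \<open>i\<close> is at most
    \<open>s (Suc i) \<le> s j\<close>, while that of interval \<open>j\<close> lies strictly above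
    \<open>s j\<close>.\<close>
  have neq: "(n i, k i) \<noteq> (n j, k j)" if "i < j" "j < N" for i j
  proof -
    have "real (k i) / 2 ^ n i < real (k j) / 2 ^ n j"
      using hi [of i] lo [of j] mono [of "Suc i" j] that by fastforce
    then show ?thesis by auto
  qed
  have inj: "inj_on (\<lambda>i. (n i, k i)) {..<N}"
    by (intro inj_onI) (metis neq lessThan_iff linorder_neqE_nat)
  have "v \<le> (\<Sum>i<N. K powr p * q ^ n i)"
    unfolding v_eq
  proof (intro sum_mono)
    fix i assume "i \<in> {..<N}"
    then have "\<delta> (f (s (Suc i))) (f (s i)) powr p \<le> (K * r ^ n i) powr p"
      using \<delta> nonneg \<open>0 \<le> p\<close> by (intro powr_mono2) auto
    also have "\<dots> = K powr p * q ^ n i"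
      using \<open>0 < r\<close> \<open>0 \<le> K\<close>
      by (simp add: q_def powr_mult powr_powr mult.commute flip: powr_realpow)
    finally show "\<delta> (f (s (Suc i))) (f (s i)) powr p \<le> K powr p * q ^ n i" .
  qed
  also have "\<dots> = K powr p * (\<Sum>(n, k)\<in>(\<lambda>i. (n i, k i)) ` {..<N}. q ^ n)"
    by (simp add: sum.reindex [OF inj] sum_distrib_left)
  \<comment> \<open>Filling in all numerators at all levels up to \<open>m\<close> only adds
    nonnegative terms.\<close>
  also have "(\<Sum>(n, k)\<in>(\<lambda>i. (n i, k i)) ` {..<N}. q ^ n) \<le> (\<Sum>(n, k)\<in>Sigma {..m} (\<lambda>n. {1..2 ^ n :: nat}). q ^ n)"
    using q0 k1 k2 nm by (intro sum_mono2) auto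
  also have "\<dots> = (\<Sum>n\<le>m. (2 * q) ^ n)"
    by (subst sum.Sigma [symmetric]) (auto simp: power_mult_distrib)
  also have "\<dots> \<le> (\<Sum>n. (2 * q) ^ n)"
    using q0 by (intro sum_le_suminf summable_geometric) auto
  also have "\<dots> = 1 / (1 - 2 * q)"
    using q0 by (intro suminf_geometric) auto
  finally show ?thesis
    by (simp add: q_def mult_left_mono)
qed

lemma pvar_norm_le:
  assumes le: "\<And>v. v \<in> pvar_sums \<delta> p f \<Longrightarrow> v \<le> b" and "0 < p"
  shows "finite_pvar \<delta> p f" "pvar_norm \<delta> p f \<le> b powr (1 / p)"
proof -
  \<comment> \<open>The partition with the single interval from 0 to 1 shows that the supremum is
    over a nonempty set.\<close>
  have one: "\<delta> (f 1) (f 0) powr p \<in> pvar_sums \<delta> p f"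
    unfolding pvar_sums_def by (intro CollectI exI [of _ 1] exI [of _ real]) auto
  show bdd: "finite_pvar \<delta> p f"
    unfolding finite_pvar_def by (rule bdd_aboveI [OF le])
  have "0 \<le> Sup (pvar_sums \<delta> p f)"
    using cSup_upper [OF one] bdd powr_ge_zero order_trans unfolding finite_pvar_def by blast
  moreover have "Sup (pvar_sums \<delta> p f) \<le> b"
    using one le by (intro cSup_least) auto
  ultimately show "pvar_norm \<delta> p f \<le> b powr (1 / p)"
    using \<open>0 < p\<close> by (auto simp: pvar_norm_def intro: powr_mono2)
qed

section \<open>Selections of Hoelder set-valued maps\<close>

lemma holder_le:
  assumes "holder \<delta> \<gamma> F" "s \<in> {0..1}" "t \<in> {0..1}" "s \<noteq> t"
  shows "\<delta> (F s) (F t) \<le> holder_seminorm \<delta> \<gamma> F * \<bar>s - t\<bar> powr \<gamma>"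
proof -
  have "\<delta> (F s) (F t) / \<bar>s - t\<bar> powr \<gamma> \<le> holder_seminorm \<delta> \<gamma> F"
    using assms unfolding holder_seminorm_def holder_def
    by (intro cSup_upper) (auto simp: holder_quotients_def)
  then show ?thesis
    using assms by (simp add: pos_divide_le_eq)
qed

text \<open>Working in an arbitrary metric space keeps the dimension out of the constant.\<close>

theorem (in Metric_space) holder_selection:
  fixes F :: "real \<Rightarrow> 'a set"
  assumes "0 < \<gamma>" and p: "p > 1 / \<gamma>"
    and F: "\<And>t. t \<in> {0..1} \<Longrightarrow> F t \<noteq> {} \<and> compactin mtopology (F t)"
    and hol: "holder (hausdorff_dist d) \<gamma> F" and \<xi>: "\<xi> \<in> F 0"
  defines "r \<equiv> 2 powr -\<gamma>"
  shows "\<exists>f. finite_pvar d p f \<and> (\<forall>t\<in>{0..1}. f t \<in> F t) \<and> f 0 = \<xi> \<and>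
     pvar_norm d p f \<le> (2 / (r * (1 - r)) + 2) * (1 / (1 - 2 * r powr p)) powr (1 / p)
       * holder_seminorm (hausdorff_dist d) \<gamma> F"
proof -
  define L where "L = holder_seminorm (hausdorff_dist d) \<gamma> F"
  define B where "B = 2 / (r * (1 - r)) + 2"
  have "0 < 1 / \<gamma>" using \<open>0 < \<gamma>\<close> by simp
  then have "0 < p" using p by linarith
  have r: "0 < r" "r < 1"
    using \<open>0 < \<gamma>\<close> by (auto simp: r_def powr_less_one)
  \<comment> \<open>This is where \<open>p > 1 / \<gamma>\<close> enters: it makes the exponent
    negative and the geometric series convergent.\<close>
  have "2 * r powr p = 2 powr (1 - \<gamma> * p)"
    unfolding r_def powr_powr by (simp add: powr_diff powr_minus_divide)
  also have "\<dots> < 1"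
    using p \<open>0 < \<gamma>\<close> by (intro powr_less_one) (auto simp: field_simps)
  finally have q: "2 * r powr p < 1" .
  have near: "\<exists>y\<in>F t. d x y \<le> L * \<bar>s - t\<bar> powr \<gamma>"
    if st: "s \<in> {0..1}" "t \<in> {0..1}" and x: "x \<in> F s" for s t x
  \<comment> \<open>Hoelder quotients exist only for distinct times; for equal times
    \<open>x\<close> itself serves.\<close>
  proof (cases "s = t")
    case True
    have "x \<in> M"
      using F [OF st(1)] x compactin_subset_topspace by fastforce
    then show ?thesis using True x by (intro bexI [of _ x]) auto
  next
    case False
    obtain y where "y \<in> F t" "d x y \<le> hausdorff_dist d (F s) (F t)"
      using hausdorff_dist_nearest_point F st x by metis
    then show ?thesis
      using holder_le [OF hol st False] unfolding L_def by force
  qed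
  have "0 \<le> L"
  proof -
    \<comment> \<open>Between times 0 and 1 the factor
      \<open>\<bar>s - t\<bar> powr \<gamma>\<close> is 1, so \<open>L\<close> bounds a
      distance.\<close>
    obtain y where "d \<xi> y \<le> L"
      using near [OF _ _ \<xi>, of 1] by auto
    then show ?thesis by (rule order_trans [OF nonneg])
  qed
  have cpt: "compactin mtopology (F t)" if "t \<in> {0..1}" for t
    using F that by blast
  obtain f where f: "\<And>t. t \<in> {0..1} \<Longrightarrow> f t \<in> F t" "f 0 = \<xi>"
    and fd: "\<And>s t n. s \<in> {0..1} \<Longrightarrow> t \<in> {0..1} \<Longrightarrow>
           (\<And>m. m < n \<Longrightarrow> dyadic_floor m s = dyadic_floor m t) \<Longrightarrow> d (f t) (f s) \<le> B * L * r ^ n"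
  proof (rule dyadic_walk_selection [of F L \<gamma> \<xi>, folded r_def, folded B_def], goal_cases)
    case (2 s t x)
    then show ?case by (intro near)
  next
    case (6 f)
    show thesis by (rule 6(1) [OF 6(2-4)])
  qed (use cpt \<open>0 < \<gamma>\<close> \<open>0 \<le> L\<close> \<xi> in auto)
  have BL: "0 \<le> B * L" using r \<open>0 \<le> L\<close> by (simp add: B_def)
  have "v \<le> (B * L) powr p / (1 - 2 * r powr p)" if "v \<in> pvar_sums d p f" for v
    by (rule pvar_sums_le [OF nonneg _ BL _ r(1) q that])
      (use fd \<open>0 < p\<close> in \<open>simp_all only: less_imp_le\<close>)
  note pvar = pvar_norm_le [OF this \<open>0 < p\<close>]
  have "((B * L) powr p / (1 - 2 * r powr p)) powr (1 / p)
      = ((B * L) powr p * (1 / (1 - 2 * r powr p))) powr (1 / p)"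
    by simp
  also have "\<dots> = B * (1 / (1 - 2 * r powr p)) powr (1 / p) * L"
    using BL q \<open>0 < p\<close> by (subst powr_mult) (auto simp: powr_powr)
  finally have "pvar_norm d p f \<le> B * (1 / (1 - 2 * r powr p)) powr (1 / p) * L"
    using pvar(2) by simp
  then show ?thesis
    using f pvar(1) unfolding B_def L_def by blast
qed

theorem theorem1p2:
  fixes \<gamma> p :: real
  assumes "0 < \<gamma>" and "\<gamma> \<le> 1" and "p > 1 / \<gamma>"
  shows "\<exists>C::real. \<forall>(d::nat) (F :: real \<Rightarrow> (nat \<Rightarrow> real) set) (\<xi> :: nat \<Rightarrow> real).
    (\<forall>t\<in>{0..1}. F t \<noteq> {} \<and> compactin (Euclidean_space d) (F t)) \<longrightarrow>
    Metric_space.mbounded (topspace (Euclidean_space d)) (euclid_dist d) (\<Union>t\<in>{0..1}. F t) \<longrightarrow>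
    holder (hausdorff_dist (euclid_dist d)) \<gamma> F \<longrightarrow>
    \<xi> \<in> F 0 \<longrightarrow>
    (\<exists>f :: real \<Rightarrow> (nat \<Rightarrow> real).
       finite_pvar (euclid_dist d) p f \<and>
       (\<forall>t\<in>{0..1}. f t \<in> F t) \<and>
       f 0 = \<xi> \<and>
       pvar_norm (euclid_dist d) p f \<le> C * holder_seminorm (hausdorff_dist (euclid_dist d)) \<gamma> F)"
proof -
  define r where "r = 2 powr -\<gamma>"
  define C where "C = (2 / (r * (1 - r)) + 2) * (1 / (1 - 2 * r powr p)) powr (1 / p)"
  show ?thesis
  \<comment> \<open>\<open>C\<close> is built from \<open>\<gamma>\<close> and \<open>p\<close>
    alone, before \<open>d\<close>, \<open>F\<close> and \<open>\<xi>\<close> are fixed.\<close>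
  proof (intro exI [of _ C] allI impI)
    fix d :: nat and F :: "real \<Rightarrow> (nat \<Rightarrow> real) set" and \<xi> :: "nat \<Rightarrow> real"
    assume F: "\<forall>t\<in>{0..1}. F t \<noteq> {} \<and> compactin (Euclidean_space d) (F t)"
      and hol: "holder (hausdorff_dist (euclid_dist d)) \<gamma> F" and \<xi>: "\<xi> \<in> F 0"
    interpret Metric_space "topspace (Euclidean_space d)" "euclid_dist d"
      by (rule Metric_space_euclid_dist)
    have "F t \<noteq> {} \<and> compactin mtopology (F t)" if "t \<in> {0..1}" for t
      using F that unfolding mtopology_euclid_dist by blast
    from holder_selection [OF assms(1,3) this hol \<xi>]
    show "\<exists>f. finite_pvar (euclid_dist d) p f \<and> (\<forall>t\<in>{0..1}. f t \<in> F t) \<and> f 0 = \<xi> \<and>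
       pvar_norm (euclid_dist d) p f \<le> C * holder_seminorm (hausdorff_dist (euclid_dist d)) \<gamma> F"
      unfolding C_def r_def .
  qed
qed

end
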